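(* Let $p=2$ and suppose that all letters carry the same label. Then for every $n\in\mathbb{N}$ $$|\mathcal{NC}(W^n)|=|\mathcal{NC}^2(\widetilde W^n)|=4^nR_n(2,1/2),$$ where $W=122^*1^*$, $\widetilde W=12344^*3^*2^*1^*$ and $R_n(2,1/2)$ is a Raney number.
   Context: **Raney numbers.** For $p,r\in\mathbb{R}_+$, $R_n(p,r)=\frac{r}{(p+1)n+r}\binom{(p+1)n+r}{n}$, where $\binom{x}{n}=x(x-1)\cdots(x-n+1)/n!$ for $x\in\mathbb{R}$. **The set $\mathcal{NC}(W^n)$.** For a noncrossing partition $\pi$ of $\{1,\ldots,4n\}$ and a block $V=\{s_1<\ldots<s_m\}$ put $\pi(s_i)=s_{i+1}$ for $i<m$ and $\pi(s_m)=s_1$. Since all letters have the same label, $\mathcal{NC}(W^n)$ is the set of noncrossing partitions $\pi$ of $\{1,\ldots,4n\}$ such that for each $s$ either $\pi(s)\equiv s+1\pmod 4$ or $\pi(s)\equiv 1-s\pmod 4$. **The set $\mathcal{NC}^2(\widetilde W^n)$.** This is the set of noncrossing pair partitions of $\{1,\ldots,8n\}$ such that, when the element $s$ is colored by the $s$-th letter of $\widetilde W^n$, the two elements of each block are colored by $\{i,i^*\}$ for some $i\in\{1,2,3,4\}$, or by $\{2,3\}$, or by $\{3^*,2^*\}$. *)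

theory Defs
  imports
    "HOL-Number_Theory.Cong"
    "HOL-Library.Disjoint_Sets"
    Complex_Main
begin

definition raney :: "real \<Rightarrow> real \<Rightarrow> nat \<Rightarrow> real" where
  "raney p r n = r / ((p + 1) * real n + r) * (((p + 1) * real n + r) gchoose n)"

definition noncrossing :: "nat set set \<Rightarrow> bool" where
  "noncrossing P \<longleftrightarrow>
     (\<forall>U\<in>P. \<forall>V\<in>P. \<forall>a\<in>U. \<forall>b\<in>V. \<forall>c\<in>U. \<forall>d\<in>V.
        a < b \<and> b < c \<and> c < d \<longrightarrow> U = V)"

definition noncrossing_partition_on :: "nat set \<Rightarrow> nat set set \<Rightarrow> bool" where
  "noncrossing_partition_on A P \<longleftrightarrow> partition_on A P \<and> noncrossing P"

(* The cyclic successor of s in its block V = {s_1 < ... < s_m}, i.e. the value pi(s). *)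
definition block_succ :: "nat set \<Rightarrow> nat \<Rightarrow> nat" where
  "block_succ V s = (if s = Max V then Min V else Min {t \<in> V. s < t})"

(* W = 1 2 2* 1* with all letters of the same label.  The word W enters only through
   residues modulo 4: s = 1, 2, 3, 0 (mod 4) is a position of the letter 1, 2, 2*, 1*.
   The congruences are over int because 1 - s is negative for s > 1. *)
definition NC_W :: "nat \<Rightarrow> nat set set set" where
  "NC_W n = {P. noncrossing_partition_on {1..4 * n} P \<and>
     (\<forall>V\<in>P. \<forall>s\<in>V.
        [int (block_succ V s) = int s + 1] (mod 4) \<or>
        [int (block_succ V s) = 1 - int s] (mod 4))}"

(* Plain i is the letter i, Star i is the letter i*. *)
datatype letter = Plain nat | Star nat

definition W_tilde :: "letter list" where
  "W_tilde = [Plain 1, Plain 2, Plain 3, Plain 4, Star 4, Star 3, Star 2, Star 1]"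

(* Positions are numbered from 1, list indices from 0. *)
definition color :: "nat \<Rightarrow> nat \<Rightarrow> letter" where
  "color n s = concat (replicate n W_tilde) ! (s - 1)"

definition admissible_colors :: "letter set set" where
  "admissible_colors =
     {{Plain i, Star i} | i. i \<in> {1, 2, 3, 4}} \<union> {{Plain 2, Plain 3}, {Star 3, Star 2}}"

definition NC2_W_tilde :: "nat \<Rightarrow> nat set set set" where
  "NC2_W_tilde n = {P. noncrossing_partition_on {1..8 * n} P \<and>
     (\<forall>V\<in>P. card V = 2 \<and> color n ` V \<in> admissible_colors)}"

end

theory Submission
  imports
    Defs
    "HOL-Computational_Algebra.Polynomial"
    "HOL-Computational_Algebra.Formal_Power_Series"
begin

text \<open>
  The two cardinalities agree because a noncrossing partition is encoded by the boundary of its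
  blocks. Replace every point \<open>s\<close> by two neighbouring points \<open>2 s - 1\<close> and \<open>2 s\<close>, and join \<open>2 s\<close> to
  \<open>2 \<pi>(s) - 1\<close>, where \<open>\<pi>(s)\<close> is the cyclic successor of \<open>s\<close> in its block. The result is a noncrossing
  pairing, and the blocks are recovered from it: two points lie in the same block iff no arc separates
  them (\<open>bij_betw_arcs\<close>). Under this encoding the congruences on \<open>\<pi>(s)\<close> modulo 4 become the condition
  on the colours of the two ends of an arc (\<open>matches_arc_iff\<close>).

  For the common value, a noncrossing pairing splits at the partner of its first point into two
  independent noncrossing pairings (\<open>card_pairings_rec\<close>). Whether two positions may be joined depends
  on their residues modulo 8 only, so the generating functions of the pairings of intervals, sorted by
  the first letter and by the length modulo 8, satisfy a finite system of polynomial equations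
  (\<open>series_system\<close>). The symmetry exchanging the letters \<open>i\<close> and \<open>(5 - i)*\<close>, a shift by 4 positions, halves
  the system. Elimination (\<open>system_solution\<close>) leaves
  \<open>f\<^sup>2 = 1 + 4 z f\<^sup>6\<close> for the generating function \<open>f\<close> of the numbers \<open>card (NC2_W_tilde n)\<close>.

  The coefficients of \<open>f\<close> are then read off without Lagrange inversion. The equation gives
  \<open>f\<^bsup>k + 2\<^esup> = f\<^bsup>k\<^esup> + 4 z f\<^bsup>k + 6\<^esup>\<close>, which is Pascal's rule for the numbers \<open>4\<^sup>n R\<^sub>n(2, k / 2)\<close>. Hence
  these are the coefficients of \<open>f\<^sup>k\<close> for even \<open>k\<close>. For fixed \<open>n\<close> both sides are polynomials in \<open>k\<close>, so
  they agree for all \<open>k\<close>, in particular for \<open>k = 1\<close> (\<open>power_nth_eq_raney3\<close>).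
\<close>

unbundle fps_syntax

section \<open>Noncrossing partitions and the arcs of their blocks\<close>

text \<open>The arc from \<open>2 s\<close> to \<open>2 t - 1\<close> passes above both copies \<open>2 a - 1\<close> and \<open>2 a\<close> of the point \<open>a\<close>. For
  \<open>s < t\<close> this means \<open>s < a < t\<close>; for \<open>t \<le> s\<close> the arc starts at the left copy of \<open>t\<close> and ends at the right
  copy of \<open>s\<close>, so it also covers \<open>s\<close> and \<open>t\<close> themselves.\<close>
definition under_arc :: "nat \<Rightarrow> nat \<Rightarrow> nat \<Rightarrow> bool" where
  "under_arc s t a \<longleftrightarrow> (s < a \<or> t \<le> a) \<and> (a \<le> s \<or> a < t)"

text \<open>The cyclic successor in terms of arcs: an arc between neighbouring points of a block covers no
  point of the block, while the arc from the maximum back to the minimum covers all of them.\<close>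
lemma block_succ_eqI:
  assumes "finite V" "s \<in> V" "t \<in> V" and g: "\<And>a. a \<in> V \<Longrightarrow> under_arc s t a \<longleftrightarrow> t \<le> s"
  shows "block_succ V s = t"
proof (cases "t \<le> s")
  case True
  then have bd: "t \<le> a" "a \<le> s" if "a \<in> V" for a
    using g[OF that] by (auto simp: under_arc_def)
  have "Max V = s" using assms bd by (intro Max_eqI) auto
  moreover have "Min V = t" using assms bd by (intro Min_eqI) auto
  ultimately show ?thesis by (simp add: block_succ_def)
next
  case False
  then have st: "s < t" by simp
  then have bd: "a \<le> s \<or> t \<le> a" if "a \<in> V" for a
    using g[OF that] by (auto simp: under_arc_def)
  have "s \<noteq> Max V" using assms st by (metis Max_ge leD)
  moreover have "Min {x \<in> V. s < x} = t"
    using assms st bd by (intro Min_eqI) force+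
  ultimately show ?thesis by (simp add: block_succ_def)
qed

lemma block_succ_in:
  assumes "finite V" "s \<in> V"
  shows "block_succ V s \<in> V"
proof (cases "s = Max V")
  case True
  then show ?thesis using assms by (auto simp: block_succ_def intro!: Min_in)
next
  case False
  then have "Max V \<in> {x \<in> V. s < x}"
    using assms by (metis (mono_tags, lifting) Max_ge Max_in empty_iff mem_Collect_eq nat_less_le)
  then have "Min {x \<in> V. s < x} \<in> {x \<in> V. s < x}"
    using assms by (intro Min_in) auto
  then show ?thesis using False by (simp add: block_succ_def)
qed

lemma under_arc_block_succ:
  assumes "finite V" "s \<in> V" "a \<in> V"
  shows "under_arc s (block_succ V s) a \<longleftrightarrow> block_succ V s \<le> s"
proof (cases "s = Max V")
  case True
  then have "Min V \<le> a" "a \<le> s" "Min V \<le> s" using assms by auto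
  then show ?thesis using True by (auto simp: block_succ_def under_arc_def)
next
  case False
  then have "Max V \<in> {x \<in> V. s < x}"
    using assms by (metis (mono_tags, lifting) Max_ge Max_in empty_iff mem_Collect_eq nat_less_le)
  then have "Min {x \<in> V. s < x} \<in> {x \<in> V. s < x}"
    using assms by (intro Min_in) auto
  moreover have "Min {x \<in> V. s < x} \<le> a" if "s < a"
    using assms that by (intro Min_le) auto
  ultimately show ?thesis using False by (auto simp: block_succ_def under_arc_def)
qed

lemma inj_on_block_succ:
  assumes "finite V"
  shows "inj_on (block_succ V) V"
proof (rule inj_onI)
  fix s s' assume s: "s \<in> V" "s' \<in> V" and e: "block_succ V s = block_succ V s'"
  define t where "t = block_succ V s"
  have "under_arc s t s' \<longleftrightarrow> t \<le> s" "under_arc s' t s \<longleftrightarrow> t \<le> s'"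
    using under_arc_block_succ[OF assms s] under_arc_block_succ[OF assms s(2,1)] by (simp_all add: t_def e)
  moreover have "under_arc s t t \<longleftrightarrow> t \<le> s" "under_arc s' t t \<longleftrightarrow> t \<le> s'"
    using under_arc_block_succ[OF assms s(1)] under_arc_block_succ[OF assms s(2)] block_succ_in[OF assms s(1)]
    by (simp_all add: t_def e)
  ultimately show "s = s'" by (auto simp: under_arc_def)
qed

lemma block_succ_image:
  assumes "finite V"
  shows "block_succ V ` V = V"
  using assms block_succ_in inj_on_block_succ by (intro endo_inj_surj) auto

lemma noncrossingD:
  assumes "noncrossing P" "U \<in> P" "V \<in> P" "a \<in> U" "b \<in> V" "c \<in> U" "d \<in> V" "a < b" "b < c" "c < d"
  shows "U = V"
  using assms unfolding noncrossing_def by blast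

text \<open>A second block with one point under the arc and one point outside would cross the block of \<open>s\<close>,
  and the block of \<open>s\<close> itself lies on one side of each of its arcs.\<close>
lemma under_arc_constant_on_blocks:
  assumes P: "partition_on A P" "noncrossing P" and fin: "finite V"
    and V: "V \<in> P" "s \<in> V" and U: "U \<in> P" "a \<in> U" "b \<in> U"
    and ga: "under_arc s (block_succ V s) a"
  shows "under_arc s (block_succ V s) b"
proof (cases "U = V")
  case True
  then show ?thesis using under_arc_block_succ[OF fin V(2)] U ga by auto
next
  case False
  let ?t = "block_succ V s"
  have t: "?t \<in> V" using fin V by (simp add: block_succ_in)
  have "U \<inter> V = {}" using False P V U by (auto simp: partition_on_def disjoint_def)
  then have ne: "a \<noteq> s" "b \<noteq> s" "a \<noteq> ?t" "b \<noteq> ?t" using V U t by auto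
  have cr: "\<not> (x < y \<and> y < z \<and> z < w)"
    if "x \<in> V \<and> z \<in> V \<and> y \<in> U \<and> w \<in> U \<or> x \<in> U \<and> z \<in> U \<and> y \<in> V \<and> w \<in> V" for x y z w
    using that noncrossingD[OF P(2) V(1) U(1), of x y z w] noncrossingD[OF P(2) U(1) V(1), of x y z w] False
    by blast
  show ?thesis
  proof (rule ccontr)
    assume gb: "\<not> under_arc s ?t b"
    consider "s < a" "a < ?t" "b < s" | "s < a" "a < ?t" "?t < b"
      | "?t < a" "a < s" "b < ?t" | "?t < a" "a < s" "s < b"
      using ga gb ne by (auto simp: under_arc_def)
    then show False
      using cr[of b a s ?t] cr[of s ?t a b] cr[of b a ?t s] cr[of ?t s a b] t V U by cases blast+
  qed
qed

text \<open>If \<open>b\<close> lies beyond the extreme points of \<open>V\<close>, the arc from maximum to minimum separates it from \<open>V\<close>.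
  Otherwise \<open>b\<close> lies between two neighbouring points of \<open>V\<close>, and the arc joining these two covers \<open>b\<close> but
  no point of \<open>V\<close>.\<close>
lemma under_arc_separates_blocks:
  assumes fin: "finite V" and a: "a \<in> V" and b: "b \<notin> V"
  shows "\<exists>s\<in>V. under_arc s (block_succ V s) a \<noteq> under_arc s (block_succ V s) b"
proof (cases "Min V \<le> b \<and> b \<le> Max V")
  case False
  have "Max V \<in> V" using fin a by (auto intro: Max_in)
  moreover have "Min V \<le> a" "a \<le> Max V" using fin a by auto
  ultimately show ?thesis using False by (intro bexI[of _ "Max V"]) (auto simp: under_arc_def block_succ_def)
next
  case True
  have mM: "Max V \<in> V" "Min V \<in> V" using fin a by (auto intro: Max_in Min_in)
  let ?B = "{x \<in> V. x < b}"
  \<comment> \<open>The neighbours of \<open>b\<close> in \<open>V\<close> are \<open>s\<close> and its successor.\<close>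
  define s where "s = Max ?B"
  have "Min V \<in> ?B" using True mM b by (metis (mono_tags, lifting) le_neq_implies_less mem_Collect_eq)
  then have "s \<in> ?B" unfolding s_def using fin by (intro Max_in) auto
  then have s: "s \<in> V" "s < b" by auto
  have smax: "x \<le> s" if "x \<in> V" "x < b" for x unfolding s_def using that fin by (intro Max_ge) auto
  have "b < Max V" using True mM b by (metis le_neq_implies_less)
  then have nM: "s \<noteq> Max V" using s by auto
  let ?t = "block_succ V s"
  have t: "?t \<in> V" using fin s by (simp add: block_succ_in)
  have "s < ?t"
  proof (rule ccontr)
    assume "\<not> s < ?t"
    then have "under_arc s ?t (Max V)" using under_arc_block_succ[OF fin s(1) mM(1)] by simp
    then show False using \<open>\<not> s < ?t\<close> \<open>b < Max V\<close> s by (auto simp: under_arc_def)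
  qed
  then have "b < ?t" using smax[OF t] t b by (metis leD linorder_neqE_nat)
  then have "under_arc s ?t b" using s by (auto simp: under_arc_def)
  moreover have "\<not> under_arc s ?t a" using under_arc_block_succ[OF fin s(1) a] \<open>s < ?t\<close> by simp
  ultimately show ?thesis using s by blast
qed

definition arcs :: "nat set set \<Rightarrow> nat set set" where
  "arcs P = {{2 * s, 2 * block_succ V s - 1} | V s. V \<in> P \<and> s \<in> V}"

text \<open>The version of \<open>under_arc\<close> for an arc given as an unordered pair, so that it can be used before
  one knows which of the two ends is even.\<close>
definition enclosed :: "nat set \<Rightarrow> nat \<Rightarrow> bool" where
  "enclosed q a \<longleftrightarrow> (\<exists>x\<in>q. x < 2 * a) \<and> (\<exists>y\<in>q. 2 * a \<le> y)"

text \<open>The equivalence relation whose classes are the regions left by the arcs; it yields the inverse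
  of \<open>arcs\<close>.\<close>
definition same_side :: "nat \<Rightarrow> nat set set \<Rightarrow> (nat \<times> nat) set" where
  "same_side m Q = {(a, b). a \<in> {1..m} \<and> b \<in> {1..m} \<and> (\<forall>q\<in>Q. enclosed q a = enclosed q b)}"

lemma equiv_same_side: "equiv {1..m} (same_side m Q)"
  by (auto intro!: equivI refl_onI symI transI simp: same_side_def)

lemma enclosedI: "x \<in> q \<Longrightarrow> x < 2 * a \<Longrightarrow> y \<in> q \<Longrightarrow> 2 * a \<le> y \<Longrightarrow> enclosed q a"
  by (auto simp: enclosed_def)

lemma enclosed_arc: "t \<ge> 1 \<Longrightarrow> enclosed {2 * s, 2 * t - 1} a \<longleftrightarrow> under_arc s t a"
  by (auto simp: enclosed_def under_arc_def)

lemma even_neq_odd: "1 \<le> y \<Longrightarrow> 2 * x \<noteq> 2 * y - Suc 0" for x y :: nat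
  by presburger

lemma finite_block: "partition_on A P \<Longrightarrow> finite A \<Longrightarrow> V \<in> P \<Longrightarrow> finite V"
  by (metis Sup_upper finite_subset partition_onD1)

context
  fixes m :: nat and P :: "nat set set"
  assumes P: "noncrossing_partition_on {1..m} P"
begin

lemma blocks_partition: "partition_on {1..m} P" and blocks_noncrossing: "noncrossing P"
  using P by (auto simp: noncrossing_partition_on_def)

lemma block_range: "V \<in> P \<Longrightarrow> s \<in> V \<Longrightarrow> s \<in> {1..m}"
  using blocks_partition by (auto simp: partition_on_def)

lemma block_finite: "V \<in> P \<Longrightarrow> finite V"
  using blocks_partition finite_block by blast

lemma block_unique: "V \<in> P \<Longrightarrow> s \<in> V \<Longrightarrow> U \<in> P \<Longrightarrow> s \<in> U \<Longrightarrow> U = V"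
  using blocks_partition by (auto simp: partition_on_def disjoint_def)

lemma succ_in: "V \<in> P \<Longrightarrow> s \<in> V \<Longrightarrow> block_succ V s \<in> V"
  by (simp add: block_finite block_succ_in)

lemma succ_range: "V \<in> P \<Longrightarrow> s \<in> V \<Longrightarrow> block_succ V s \<in> {1..m}"
  using succ_in block_range by blast

lemma succ_pos: "V \<in> P \<Longrightarrow> s \<in> V \<Longrightarrow> 1 \<le> block_succ V s"
  using succ_range by fastforce

lemma under_arc_block_const:
  assumes "V \<in> P" "s \<in> V" "U \<in> P" "a \<in> U" "b \<in> U"
  shows "under_arc s (block_succ V s) a = under_arc s (block_succ V s) b"
  using under_arc_constant_on_blocks[OF blocks_partition blocks_noncrossing block_finite[OF assms(1)] assms]
    under_arc_constant_on_blocks[OF blocks_partition blocks_noncrossing block_finite[OF assms(1)] assms(1-3,5,4)] by blast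

text \<open>A block can be read off from the arcs: its points are never separated from each other, and some
  arc separates them from any other point.\<close>
lemma same_side_arcs:
  assumes V: "V \<in> P" "a \<in> V"
  shows "same_side m (arcs P) `` {a} = V"
proof (intro equalityI subsetI)
  fix b assume b: "b \<in> same_side m (arcs P) `` {a}"
  show "b \<in> V"
  proof (rule ccontr)
    assume "b \<notin> V"
    then obtain s where s: "s \<in> V" "under_arc s (block_succ V s) a \<noteq> under_arc s (block_succ V s) b"
      using under_arc_separates_blocks[OF block_finite[OF V(1)] V(2)] by blast
    have "{2 * s, 2 * block_succ V s - 1} \<in> arcs P" using V s(1) unfolding arcs_def by blast
    then have "enclosed {2 * s, 2 * block_succ V s - 1} a = enclosed {2 * s, 2 * block_succ V s - 1} b"
      using b unfolding same_side_def by blast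
    then show False using s(2) unfolding enclosed_arc[OF succ_pos[OF V(1) s(1)]] by blast
  qed
next
  fix b assume b: "b \<in> V"
  have "enclosed q a = enclosed q b" if q: "q \<in> arcs P" for q
  proof -
    obtain U s where U: "U \<in> P" "s \<in> U" "q = {2 * s, 2 * block_succ U s - 1}"
      using q by (auto simp: arcs_def)
    show ?thesis
      unfolding U(3) enclosed_arc[OF succ_pos[OF U(1,2)]] by (rule under_arc_block_const[OF U(1,2) V b])
  qed
  then show "b \<in> same_side m (arcs P) `` {a}" using V b block_range by (auto simp: same_side_def)
qed

lemma quotient_same_side_arcs: "{1..m} // same_side m (arcs P) = P"
proof (intro equalityI subsetI)
  fix V assume "V \<in> {1..m} // same_side m (arcs P)"
  then obtain a where a: "a \<in> {1..m}" "V = same_side m (arcs P) `` {a}" by (auto elim: quotientE)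
  then obtain U where "U \<in> P" "a \<in> U" using partition_onD1[OF blocks_partition] by blast
  then show "V \<in> P" using same_side_arcs a by simp
next
  fix V assume V: "V \<in> P"
  then obtain a where a: "a \<in> V" using partition_onD3[OF blocks_partition] by fastforce
  show "V \<in> {1..m} // same_side m (arcs P)"
    using quotientI[OF block_range[OF V a], of "same_side m (arcs P)"] same_side_arcs[OF V a] by simp
qed

text \<open>Every odd position \<open>2 y - 1\<close> is the end of exactly one arc because the cyclic successor permutes
  each block.\<close>
lemma partition_on_arcs: "partition_on {1..2 * m} (arcs P)"
proof (rule partition_onI)
  show "\<Union> (arcs P) = {1..2 * m}"
  proof (intro equalityI subsetI)
    fix x assume "x \<in> \<Union> (arcs P)"
    then obtain V s where Vs: "V \<in> P" "s \<in> V" "x \<in> {2 * s, 2 * block_succ V s - 1}"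
      by (auto simp: arcs_def)
    show "x \<in> {1..2 * m}" using Vs block_range[OF Vs(1,2)] succ_range[OF Vs(1,2)] by auto
  next
    fix x assume x: "x \<in> {1..2 * m}"
    define y where "y = (x + 1) div 2"
    have y: "y \<in> {1..m}" and xy: "x = 2 * y \<or> x = 2 * y - 1" using x unfolding y_def by auto
    obtain V where V: "V \<in> P" "y \<in> V" using y partition_onD1[OF blocks_partition] by blast
    have "y \<in> block_succ V ` V" using V block_succ_image[OF block_finite[OF V(1)]] by simp
    then obtain s where s: "s \<in> V" "y = block_succ V s" by blast
    have "{2 * y, 2 * block_succ V y - 1} \<in> arcs P" "{2 * s, 2 * y - 1} \<in> arcs P"
      using V s by (auto simp: arcs_def)
    then show "x \<in> \<Union> (arcs P)" using xy by blast
  qed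
next
  show "{} \<notin> arcs P" by (auto simp: arcs_def)
next
  fix p q assume pq: "p \<in> arcs P" "q \<in> arcs P" "p \<noteq> q"
  obtain U s where U: "U \<in> P" "s \<in> U" "p = {2 * s, 2 * block_succ U s - 1}"
    using pq by (auto simp: arcs_def)
  obtain V t where V: "V \<in> P" "t \<in> V" "q = {2 * t, 2 * block_succ V t - 1}"
    using pq by (auto simp: arcs_def)
  show "disjnt p q"
  proof (rule ccontr)
    assume "\<not> disjnt p q"
    then obtain x where x: "x = 2 * s \<or> x = 2 * block_succ U s - 1"
      "x = 2 * t \<or> x = 2 * block_succ V t - 1"
      unfolding U(3) V(3) disjnt_def by blast
    have pos: "1 \<le> block_succ U s" "1 \<le> block_succ V t"
      using succ_pos[OF U(1,2)] succ_pos[OF V(1,2)] .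
    have "s = t \<or> block_succ U s = block_succ V t" 
      using x pos even_neq_odd[OF pos(1), of t] even_neq_odd[OF pos(2), of s] by (elim disjE) (simp_all, linarith)
    then have st: "s = t \<or> U = V \<and> block_succ U s = block_succ V t"
      using block_unique[OF U(1) succ_in[OF U(1,2)] V(1)] succ_in[OF V(1,2)] by auto
    then have "U = V" using block_unique[OF U(1,2) V(1)] V(2) by auto
    moreover have "s = t" using st \<open>U = V\<close> inj_onD[OF inj_on_block_succ[OF block_finite[OF U(1)]] _ U(2)] V(2) by auto
    ultimately show False using U V pq by simp
  qed
qed

text \<open>If two arcs crossed, the first would cover exactly one of the two points joined by the second,
  although these points belong to one block.\<close>
lemma noncrossing_arcs: "noncrossing (arcs P)"
  unfolding noncrossing_def
proof (intro ballI impI)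
  fix p q a b c d
  assume pq: "p \<in> arcs P" "q \<in> arcs P" and mem: "a \<in> p" "b \<in> q" "c \<in> p" "d \<in> q"
    and ord: "a < b \<and> b < c \<and> c < d"
  obtain U s where U: "U \<in> P" "s \<in> U" "p = {2 * s, 2 * block_succ U s - 1}"
    using pq by (auto simp: arcs_def)
  obtain V t where V: "V \<in> P" "t \<in> V" "q = {2 * t, 2 * block_succ V t - 1}"
    using pq by (auto simp: arcs_def)
  have e: "enclosed p t = enclosed p (block_succ V t)"
    unfolding U(3) enclosed_arc[OF succ_pos[OF U(1,2)]]
    by (rule under_arc_block_const[OF U(1,2) V(1,2) succ_in[OF V(1,2)]])
  have pac: "p = {a, c}" using mem(1,3) ord unfolding U(3) by auto
  have "b = 2 * t \<and> d = 2 * block_succ V t - 1 \<or> d = 2 * t \<and> b = 2 * block_succ V t - 1"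
    using mem(2,4) ord unfolding V(3) by auto
  then have False using e ord succ_pos[OF V(1,2)] unfolding pac enclosed_def by auto
  then show "p = q" ..
qed

end

text \<open>The points enclosed by a set form an interval. If \<open>a < b < c < d\<close>, then an interval containing both or
  neither of \<open>a\<close>, \<open>c\<close>, and both or neither of \<open>b\<close>, \<open>d\<close>, cannot separate \<open>a\<close> from \<open>b\<close>.\<close>
lemma noncrossing_quotient_same_side: "noncrossing ({1..m} // same_side m Q)"
  unfolding noncrossing_def
proof (intro ballI impI)
  fix U V a b c d
  assume UV: "U \<in> {1..m} // same_side m Q" "V \<in> {1..m} // same_side m Q"
    and mem: "a \<in> U" "b \<in> V" "c \<in> U" "d \<in> V" and ord: "a < b \<and> b < c \<and> c < d"
  note eq = equiv_same_side[of m Q]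
  have ac: "(a, c) \<in> same_side m Q" and bd: "(b, d) \<in> same_side m Q"
    using quotient_eq_iff[OF eq] UV mem by blast+
  have "enclosed q a = enclosed q b" if q: "q \<in> Q" for q
  proof -
    have e: "enclosed q a = enclosed q c" "enclosed q b = enclosed q d"
      using ac bd q by (auto simp: same_side_def)
    show ?thesis
    proof
      assume "enclosed q a"
      then obtain x y where "x \<in> q" "x < 2 * a" "y \<in> q" "2 * c \<le> y" using e by (auto simp: enclosed_def)
      then show "enclosed q b" using ord by (intro enclosedI[of x _ _ y]) auto
    next
      assume "enclosed q b"
      then obtain x y where "x \<in> q" "x < 2 * b" "y \<in> q" "2 * d \<le> y" using e by (auto simp: enclosed_def)
      then have "enclosed q c" using ord by (intro enclosedI[of x _ _ y]) auto
      then show "enclosed q a" using e by simp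
    qed
  qed
  then have "(a, b) \<in> same_side m Q" using ac bd by (auto simp: same_side_def)
  then show "U = V" using quotient_eq_iff[OF eq] UV mem by blast
qed

text \<open>No arc separates \<open>s\<close> from \<open>t\<close>, since it would cross the arc joining them. The arc joining them
  excludes from their class all points that could come between \<open>s\<close> and \<open>t\<close> in the cyclic order.\<close>
lemma block_succ_quotient:
  assumes Q: "noncrossing_partition_on {1..2 * m} Q"
    and st: "{2 * s, 2 * t - 1} \<in> Q" "s \<in> {1..m}" "t \<in> {1..m}"
    and V: "V \<in> {1..m} // same_side m Q" "s \<in> V"
  shows "block_succ V s = t"
proof -
  let ?p = "{2 * s, 2 * t - 1}"
  note eq = equiv_same_side[of m Q]
  have part: "partition_on {1..2 * m} Q" and nc: "noncrossing Q"
    using Q by (auto simp: noncrossing_partition_on_def)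
  have Vs: "V = same_side m Q `` {s}"
    using V eq by (metis Image_singleton_iff equiv_class_eq quotientE)
  then have rel: "(s, a) \<in> same_side m Q \<longleftrightarrow> a \<in> V" for a by simp
  have "enclosed q s = enclosed q t" if q: "q \<in> Q" for q
  proof (cases "q = ?p")
    case True
    then show ?thesis using st by (auto simp: enclosed_def)
  next
    case False
    then have "q \<inter> ?p = {}" using part q st by (auto simp: partition_on_def disjoint_def)
    then have ne: "x \<noteq> 2 * s" "x \<noteq> 2 * t - 1" if "x \<in> q" for x using that by auto
    have cr: "\<not> (x < y \<and> y < z \<and> z < w)"
      if "x \<in> ?p \<and> z \<in> ?p \<and> y \<in> q \<and> w \<in> q \<or> x \<in> q \<and> z \<in> q \<and> y \<in> ?p \<and> w \<in> ?p" for x y z w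
      using that noncrossingD[OF nc st(1) q, of x y z w] noncrossingD[OF nc q st(1), of x y z w] False
      by blast
    show ?thesis
    proof
      assume "enclosed q s"
      then obtain x y where xy: "x \<in> q" "x < 2 * s" "y \<in> q" "2 * s < y"
        using ne by (auto simp: enclosed_def) (metis le_neq_implies_less)
      have "x < 2 * t - 1" "2 * t - 1 < y"
        using cr[of "2 * t - 1" "2 * s" x y] cr[of x y "2 * s" "2 * t - 1"] xy ne[of x] ne[of y]
        by (auto simp: not_less)
      then show "enclosed q t" using xy st by (intro enclosedI[of x _ _ y]) auto
    next
      assume "enclosed q t"
      then obtain x y where xy0: "x \<in> q" "x < 2 * t" "y \<in> q" "2 * t \<le> y"
        by (auto simp: enclosed_def)
      then have xy: "x \<in> q" "x < 2 * t - 1" "y \<in> q" "2 * t - 1 < y"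
        using ne[of x] st by auto
      have "x < 2 * s" "2 * s < y"
        using cr[of "2 * s" "2 * t - 1" x y] cr[of x y "2 * t - 1" "2 * s"] xy ne[of x] ne[of y]
        by (auto simp: not_less)
      then show "enclosed q s" using xy st by (intro enclosedI[of x _ _ y]) auto
    qed
  qed
  then have "t \<in> V" using st rel by (auto simp: same_side_def)
  moreover have "under_arc s t a \<longleftrightarrow> t \<le> s" if "a \<in> V" for a
  proof -
    have "enclosed ?p s = enclosed ?p a" using that rel st(1) by (auto simp: same_side_def)
    then have "under_arc s t a = under_arc s t s" using st enclosed_arc[of t s] by auto
    then show ?thesis by (auto simp: under_arc_def)
  qed
  moreover have "finite V" unfolding Vs by (rule finite_subset[of _ "{1..m}"]) (auto simp: same_side_def)
  ultimately show ?thesis using V by (intro block_succ_eqI)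
qed

text \<open>The encoding of partitions by pairings, refined by an arbitrary condition \<open>R\<close> relating each point
  to its cyclic successor; on the side of the pairings it constrains the two ends of every arc.\<close>
lemma bij_betw_arcs:
  fixes R :: "nat \<Rightarrow> nat \<Rightarrow> bool" and m :: nat
  shows "bij_betw arcs
    {P. noncrossing_partition_on {1..m} P \<and> (\<forall>V\<in>P. \<forall>s\<in>V. R s (block_succ V s))}
    {Q. noncrossing_partition_on {1..2 * m} Q \<and>
      (\<forall>q\<in>Q. \<exists>s\<in>{1..m}. \<exists>t\<in>{1..m}. q = {2 * s, 2 * t - 1} \<and> R s t)}"
  (is "bij_betw _ ?PP ?QQ")
proof (rule bij_betw_imageI)
  show "inj_on arcs ?PP"
    by (rule inj_onI) (metis (no_types, lifting) mem_Collect_eq quotient_same_side_arcs)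
next
  show "arcs ` ?PP = ?QQ"
  proof (intro equalityI subsetI)
    fix Q assume "Q \<in> arcs ` ?PP"
    then obtain P where P: "noncrossing_partition_on {1..m} P"
      "\<forall>V\<in>P. \<forall>s\<in>V. R s (block_succ V s)" and Q: "Q = arcs P" by auto
    have "\<exists>s\<in>{1..m}. \<exists>t\<in>{1..m}. q = {2 * s, 2 * t - 1} \<and> R s t" if q: "q \<in> Q" for q
    proof -
      obtain V s where V: "V \<in> P" "s \<in> V" "q = {2 * s, 2 * block_succ V s - 1}"
        using q Q by (auto simp: arcs_def)
      show ?thesis using V P(2) block_range[OF P(1) V(1,2)] succ_range[OF P(1) V(1,2)] by blast
    qed
    then show "Q \<in> ?QQ"
      using partition_on_arcs[OF P(1)] noncrossing_arcs[OF P(1)] Q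
      by (auto simp: noncrossing_partition_on_def)
  next
    fix Q assume "Q \<in> ?QQ"
    then have Q: "noncrossing_partition_on {1..2 * m} Q"
      and ex: "\<And>q. q \<in> Q \<Longrightarrow> \<exists>s\<in>{1..m}. \<exists>t\<in>{1..m}. q = {2 * s, 2 * t - 1} \<and> R s t" by auto
    have part: "partition_on {1..2 * m} Q" using Q by (simp add: noncrossing_partition_on_def)
    let ?P = "{1..m} // same_side m Q"
    have eq: "equiv {1..m} (same_side m Q)"
      by (auto intro!: equivI refl_onI symI transI simp: same_side_def)
    have ncP: "noncrossing_partition_on {1..m} ?P"
      using partition_on_quotient[OF eq] noncrossing_quotient_same_side
      by (simp add: noncrossing_partition_on_def)
    have arc: "\<exists>t. block_succ V s = t \<and> {2 * s, 2 * t - 1} \<in> Q \<and> R s t"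
      if V: "V \<in> ?P" "s \<in> V" for V s
    proof -
      have s: "s \<in> {1..m}" using V eq by (metis in_quotient_imp_subset subsetD)
      then have "2 * s \<in> \<Union> Q" unfolding partition_onD1[OF part, symmetric] by auto
      then obtain q where q: "q \<in> Q" "2 * s \<in> q" by blast
      obtain s' t where st: "s' \<in> {1..m}" "t \<in> {1..m}" "q = {2 * s', 2 * t - 1}" "R s' t"
        using ex q by blast
      have "2 * s \<noteq> 2 * t - 1" using even_neq_odd[of t s] st(2) by simp
      then have "s' = s" using q(2) unfolding st(3) by simp
      then have "{2 * s, 2 * t - 1} \<in> Q" "R s t" using st q(1) by simp_all
      then show ?thesis using block_succ_quotient[OF Q _ s st(2) V] by blast
    qed
    have "arcs ?P = Q"
    proof (intro equalityI subsetI)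
      fix q assume "q \<in> arcs ?P"
      then obtain V s where V: "V \<in> ?P" "s \<in> V" "q = {2 * s, 2 * block_succ V s - 1}"
        unfolding arcs_def by blast
      then show "q \<in> Q" using arc[OF V(1,2)] by simp
    next
      fix q assume q: "q \<in> Q"
      then obtain s t where st: "s \<in> {1..m}" "t \<in> {1..m}" "q = {2 * s, 2 * t - 1}" using ex by blast
      have V: "same_side m Q `` {s} \<in> ?P" "s \<in> same_side m Q `` {s}"
        by (rule quotientI[OF st(1)], rule equiv_class_self[OF eq st(1)])
      have "block_succ (same_side m Q `` {s}) s = t"
        using block_succ_quotient[OF Q _ st(1,2) V] q st(3) by simp
      then have "q = {2 * s, 2 * block_succ (same_side m Q `` {s}) s - 1}" using st(3) by simp
      then show "q \<in> arcs ?P" using V unfolding arcs_def by blast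
    qed
    moreover have "?P \<in> ?PP" using ncP arc by blast
    ultimately show "Q \<in> arcs ` ?PP" by blast
  qed
qed

section \<open>Noncrossing pairings split at the partner of the first point\<close>

definition pairings :: "(nat set \<Rightarrow> bool) \<Rightarrow> nat set \<Rightarrow> nat set set set" where
  "pairings ok A = {P. noncrossing_partition_on A P \<and> (\<forall>V\<in>P. card V = 2 \<and> ok V)}"

lemma finite_pairings: "finite A \<Longrightarrow> finite (pairings ok A)"
  by (rule finite_subset[OF _ finitely_many_partition_on[of A]])
    (auto simp: pairings_def noncrossing_partition_on_def)

lemma pairings_empty: "pairings ok {} = {{}}"
  by (auto simp: pairings_def noncrossing_partition_on_def partition_on_empty noncrossing_def)

lemma pairings_block_subset: "P \<in> pairings ok A \<Longrightarrow> V \<in> P \<Longrightarrow> V \<subseteq> A"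
  unfolding pairings_def noncrossing_partition_on_def partition_on_def by blast

lemma pairings_block_nonempty: "P \<in> pairings ok A \<Longrightarrow> {} \<notin> P"
  unfolding pairings_def noncrossing_partition_on_def partition_on_def by blast

lemma noncrossing_Un_before:
  assumes "noncrossing P" "noncrossing Q" "\<And>U V x y. U \<in> P \<Longrightarrow> V \<in> Q \<Longrightarrow> x \<in> U \<Longrightarrow> y \<in> V \<Longrightarrow> x < y"
  shows "noncrossing (P \<union> Q)"
  unfolding noncrossing_def
proof (intro ballI impI)
  fix U V a b c d
  assume m: "U \<in> P \<union> Q" "V \<in> P \<union> Q" "a \<in> U" "b \<in> V" "c \<in> U" "d \<in> V" and o: "a < b \<and> b < c \<and> c < d"
  have "\<not> (U \<in> P \<and> V \<in> Q)" using assms(3)[of U V c b] m o by auto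
  moreover have "\<not> (U \<in> Q \<and> V \<in> P)" using assms(3)[of V U b a] m o by auto
  ultimately consider "U \<in> P" "V \<in> P" | "U \<in> Q" "V \<in> Q" using m by blast
  then show "U = V"
    using noncrossingD[OF assms(1), of U V a b c d] noncrossingD[OF assms(2), of U V a b c d] m o
    by cases simp_all
qed

lemma noncrossing_insert_pair:
  fixes i b :: nat
  assumes "noncrossing P" "\<And>V. V \<in> P \<Longrightarrow> V \<subseteq> {i<..<b} \<or> V \<subseteq> {b<..}" "i < b"
  shows "noncrossing (insert {i, b} P)"
  unfolding noncrossing_def
proof (intro ballI impI)
  fix U V x y z w
  assume m: "U \<in> insert {i, b} P" "V \<in> insert {i, b} P" "x \<in> U" "y \<in> V" "z \<in> U" "w \<in> V"
    and o: "x < y \<and> y < z \<and> z < w"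
  consider "U = {i, b}" "V = {i, b}" | "U \<in> P" "V \<in> P" | "U = {i, b}" "V \<in> P" | "U \<in> P" "V = {i, b}"
    using m by blast
  then show "U = V"
  proof cases
    case 2
    then show ?thesis using noncrossingD[OF assms(1), of U V x y z w] m o by simp
  next
    case 3
    then have xz: "x = i" "z = b" using m o assms(3) by auto
    have "y \<in> {i<..<b}" "b < w" using o unfolding xz by auto
    then show ?thesis using assms(2)[OF 3(2)] m by fastforce
  next
    case 4
    then have "y = i" "w = b" using m o assms(3) by auto
    then have "x < i" using o by simp
    then show ?thesis using assms(2)[OF 4(1)] m assms(3) by fastforce
  qed simp
qed

lemma pairings_join:
  fixes i b j :: nat
  assumes b: "i < b" "b < j" "ok {i, b}"
    and P: "P \<in> pairings ok {Suc i..<b}" and Q: "Q \<in> pairings ok {Suc b..<j}"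
  shows "insert {i, b} (P \<union> Q) \<in> pairings ok {i..<j}"
proof -
  have p: "partition_on {Suc i..<b} P" "noncrossing P" and q: "partition_on {Suc b..<j} Q" "noncrossing Q"
    using P Q by (auto simp: pairings_def noncrossing_partition_on_def)
  have sP: "V \<subseteq> {i<..<b}" if "V \<in> P" for V
    using pairings_block_subset[OF P that] by auto
  have sQ: "V \<subseteq> {b<..}" if "V \<in> Q" for V
    using pairings_block_subset[OF Q that] by auto
  have nc: "noncrossing (insert {i, b} (P \<union> Q))"
  proof (rule noncrossing_insert_pair[OF noncrossing_Un_before[OF p(2) q(2)]])
    fix U V x y assume "U \<in> P" "V \<in> Q" "x \<in> U" "y \<in> V"
    then show "x < y" using sP[of U] sQ[of V] by fastforce
  qed (use sP sQ b in auto)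
  have pu: "partition_on ({Suc i..<b} \<union> {Suc b..<j}) (P \<union> Q)"
  proof (rule partition_onI)
    show "\<Union> (P \<union> Q) = {Suc i..<b} \<union> {Suc b..<j}"
      using partition_onD1[OF p(1)] partition_onD1[OF q(1)] by simp
    show "{} \<notin> P \<union> Q" using partition_onD3[OF p(1)] partition_onD3[OF q(1)] by simp
    fix U V assume UV: "U \<in> P \<union> Q" "V \<in> P \<union> Q" "U \<noteq> V"
    then consider "U \<in> P" "V \<in> P" | "U \<in> Q" "V \<in> Q" | "U \<in> P" "V \<in> Q" | "U \<in> Q" "V \<in> P" by blast
    then show "disjnt U V"
    proof cases
      case 1 then show ?thesis using partition_onD2[OF p(1)] UV(3) by (simp add: disjoint_def disjnt_def)
    next
      case 2 then show ?thesis using partition_onD2[OF q(1)] UV(3) by (simp add: disjoint_def disjnt_def)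
    next
      case 3 then show ?thesis using sP[of U] sQ[of V] unfolding disjnt_def by fastforce
    next
      case 4 then show ?thesis using sP[of V] sQ[of U] unfolding disjnt_def by fastforce
    qed
  qed
  have dj: "disjnt {i, b} (\<Union> (P \<union> Q))"
    unfolding partition_onD1[OF pu, symmetric] using b by (auto simp: disjnt_def)
  have "{i..<j} - {i, b} = {Suc i..<b} \<union> {Suc b..<j}" using b by auto
  then have "partition_on {i..<j} (insert {i, b} (P \<union> Q))"
    unfolding partition_on_insert[OF dj] using pu b by simp
  then show ?thesis
    using nc P Q b unfolding pairings_def noncrossing_partition_on_def by auto
qed

text \<open>The arc at the first point \<open>i\<close> cannot be crossed, so every other pair lies either below it or to
  its right.\<close>
lemma pairings_split:
  fixes i j :: nat
  assumes P: "P \<in> pairings ok {i..<j}" and ij: "i < j"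
  shows "\<exists>b Q R. i < b \<and> b < j \<and> ok {i, b} \<and> Q \<in> pairings ok {Suc i..<b} \<and>
    R \<in> pairings ok {Suc b..<j} \<and> P = insert {i, b} (Q \<union> R)"
proof -
  have part: "partition_on {i..<j} P" and nc: "noncrossing P" and two: "\<And>V. V \<in> P \<Longrightarrow> card V = 2 \<and> ok V"
    using P by (auto simp: pairings_def noncrossing_partition_on_def)
  have "i \<in> \<Union> P" using partition_onD1[OF part] ij by auto
  then obtain U where U: "U \<in> P" "i \<in> U" by blast
  obtain b where b: "U = {i, b}" "b \<noteq> i"
    using two[OF U(1)] U(2) by (metis card_2_iff doubleton_eq_iff empty_iff insertE)
  have "b \<in> {i..<j}" using pairings_block_subset[OF P U(1)] b by auto
  then have ib: "i < b" "b < j" using b by auto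
  have dj: "V \<inter> {i, b} = {}" if "V \<in> P" "V \<noteq> {i, b}" for V
    using partition_onD2[OF part] that U b by (auto simp: disjoint_def)
  have side: "V \<subseteq> {Suc i..<b} \<or> V \<subseteq> {Suc b..<j}" if V: "V \<in> P" "V \<noteq> {i, b}" for V
  proof (rule ccontr)
    assume "\<not> ?thesis"
    then obtain x y where xy: "x \<in> V" "x \<notin> {Suc i..<b}" "y \<in> V" "y \<notin> {Suc b..<j}" by blast
    have "x \<in> {i..<j}" "y \<in> {i..<j}" using pairings_block_subset[OF P V(1)] xy by auto
    moreover have "x \<noteq> i" "x \<noteq> b" "y \<noteq> i" "y \<noteq> b" using dj[OF V] xy by auto
    ultimately have "i < y" "y < b" "b < x" using xy by auto
    then have "{i, b} = V" using noncrossingD[OF nc _ V(1), of "{i, b}" i y b x] U b xy by simp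
    then show False using V by simp
  qed
  define Q where "Q = {V \<in> P. V \<subseteq> {Suc i..<b}}"
  define R where "R = {V \<in> P. V \<subseteq> {Suc b..<j}}"
  have ib_nin: "\<not> {i, b} \<subseteq> {Suc i..<b}" "\<not> {i, b} \<subseteq> {Suc b..<j}" by auto
  have eq: "P = insert {i, b} (Q \<union> R)"
    using side U b unfolding Q_def R_def by blast
  have sub: "S \<in> pairings ok B" if S: "S = {V \<in> P. V \<subseteq> B}" and B: "B \<subseteq> \<Union> S" for S B
  proof -
    have "partition_on B S"
    proof (rule partition_onI)
      show "\<Union> S = B" using B S by blast
      show "{} \<notin> S" using S partition_onD3[OF part] by simp
      show "disjnt U V" if "U \<in> S" "V \<in> S" "U \<noteq> V" for U V
        using that S partition_onD2[OF part] by (simp add: disjoint_def disjnt_def)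
    qed
    moreover have "noncrossing S" using nc S unfolding noncrossing_def by blast
    ultimately show ?thesis using S two by (simp add: pairings_def noncrossing_partition_on_def)
  qed
  have cov: "\<exists>V \<in> P. x \<in> V \<and> V \<noteq> {i, b}" if "x \<in> {i..<j}" "x \<noteq> i" "x \<noteq> b" for x
    using that partition_onD1[OF part] by auto
  have "Q \<in> pairings ok {Suc i..<b}"
  proof (rule sub[OF Q_def], rule subsetI)
    fix x assume x: "x \<in> {Suc i..<b}"
    then obtain V where V: "V \<in> P" "x \<in> V" "V \<noteq> {i, b}" using cov[of x] ib by auto
    have "\<not> V \<subseteq> {Suc b..<j}" using V(2) x by auto
    then have "V \<in> Q" using side[OF V(1,3)] V(1) unfolding Q_def by blast
    then show "x \<in> \<Union> Q" using V(2) by blast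
  qed
  moreover have "R \<in> pairings ok {Suc b..<j}"
  proof (rule sub[OF R_def], rule subsetI)
    fix x assume x: "x \<in> {Suc b..<j}"
    then obtain V where V: "V \<in> P" "x \<in> V" "V \<noteq> {i, b}" using cov[of x] ib by auto
    have "\<not> V \<subseteq> {Suc i..<b}" using V(2) x by auto
    then have "V \<in> R" using side[OF V(1,3)] V(1) unfolding R_def by blast
    then show "x \<in> \<Union> R" using V(2) by blast
  qed
  ultimately show ?thesis using ib eq two[OF U(1)] b(1) by blast
qed

lemma pairings_join_inj:
  fixes i b b' j :: nat
  assumes b: "i < b" "i < b'"
    and P: "P \<in> pairings ok {Suc i..<b}" and Q: "Q \<in> pairings ok {Suc b..<j}"
    and P': "P' \<in> pairings ok {Suc i..<b'}" and Q': "Q' \<in> pairings ok {Suc b'..<j}"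
    and eq: "insert {i, b} (P \<union> Q) = insert {i, b'} (P' \<union> Q')"
  shows "b = b' \<and> P = P' \<and> Q = Q'"
proof -
  have "i \<notin> V" if "V \<in> P' \<union> Q'" for V
    using pairings_block_subset[OF P', of V] pairings_block_subset[OF Q', of V] that b(2) by fastforce
  then have "{i, b} \<notin> P' \<union> Q'" by blast
  then have "{i, b} = {i, b'}" using eq by blast
  then have bb: "b = b'" by (auto simp: doubleton_eq_iff)
  have l: "S = {V \<in> insert {i, b} (S \<union> T). V \<subseteq> {Suc i..<b}}"
    and r: "T = {V \<in> insert {i, b} (S \<union> T). V \<subseteq> {Suc b..<j}}"
    if "S \<in> pairings ok {Suc i..<b}" "T \<in> pairings ok {Suc b..<j}" for S T
  proof -
    have s: "V \<subseteq> {Suc i..<b}" "V \<noteq> {}" if "V \<in> S" for V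
      using pairings_block_subset pairings_block_nonempty \<open>S \<in> _\<close> that by blast+
    have t: "V \<subseteq> {Suc b..<j}" "V \<noteq> {}" if "V \<in> T" for V
      using pairings_block_subset pairings_block_nonempty \<open>T \<in> _\<close> that by blast+
    have dis: "\<not> (V \<subseteq> {Suc i..<b} \<and> V \<subseteq> {Suc b..<j} \<and> V \<noteq> {})" for V by fastforce
    have nin: "\<not> {i, b} \<subseteq> {Suc i..<b}" "\<not> {i, b} \<subseteq> {Suc b..<j}" by auto
    show "S = {V \<in> insert {i, b} (S \<union> T). V \<subseteq> {Suc i..<b}}"
    proof (intro set_eqI iffI)
      fix V assume "V \<in> {V \<in> insert {i, b} (S \<union> T). V \<subseteq> {Suc i..<b}}"
      then show "V \<in> S" using t[of V] dis[of V] nin(1) by auto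
    qed (use s in simp)
    show "T = {V \<in> insert {i, b} (S \<union> T). V \<subseteq> {Suc b..<j}}"
    proof (intro set_eqI iffI)
      fix V assume "V \<in> {V \<in> insert {i, b} (S \<union> T). V \<subseteq> {Suc b..<j}}"
      then show "V \<in> T" using s[of V] dis[of V] nin(2) by auto
    qed (use t in simp)
  qed
  have PQ': "P' \<in> pairings ok {Suc i..<b}" "Q' \<in> pairings ok {Suc b..<j}"
    using P' Q' unfolding bb by simp_all
  have e: "insert {i, b} (P' \<union> Q') = insert {i, b} (P \<union> Q)" using eq unfolding bb by simp
  have "P = P'" using l[OF PQ', unfolded e] l[OF P Q] by simp
  moreover have "Q = Q'" using r[OF PQ', unfolded e] r[OF P Q] by simp
  ultimately show ?thesis using bb by simp
qed

text \<open>The recursion of the Catalan numbers, restricted to the admissible partners \<open>b\<close> of the first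
  point.\<close>
lemma card_pairings_rec:
  fixes i j :: nat
  assumes ij: "i < j"
  shows "card (pairings ok {i..<j}) =
    (\<Sum>b | i < b \<and> b < j \<and> ok {i, b}.
      card (pairings ok {Suc i..<b}) * card (pairings ok {Suc b..<j}))"
proof -
  let ?B = "{b. i < b \<and> b < j \<and> ok {i, b}}"
  let ?D = "SIGMA b:?B. pairings ok {Suc i..<b} \<times> pairings ok {Suc b..<j}"
  let ?f = "\<lambda>(b, P, Q). insert {i, b} (P \<union> Q)"
  have "bij_betw ?f ?D (pairings ok {i..<j})"
  proof (rule bij_betw_imageI)
    show "inj_on ?f ?D"
    proof (rule inj_onI)
      fix x y assume x: "x \<in> ?D" and y: "y \<in> ?D" and e: "?f x = ?f y"
      obtain b P Q b' P' Q' where xy: "x = (b, P, Q)" "y = (b', P', Q')" by (metis prod_cases3)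
      show "x = y" using x y e pairings_join_inj[of i b b' P ok Q j P' Q'] unfolding xy by simp
    qed
    show "?f ` ?D = pairings ok {i..<j}"
    proof (intro equalityI subsetI)
      fix P assume "P \<in> ?f ` ?D"
      then show "P \<in> pairings ok {i..<j}" using pairings_join by auto
    next
      fix P assume "P \<in> pairings ok {i..<j}"
      from pairings_split[OF this ij] obtain b Q R where
        b: "i < b" "b < j" "ok {i, b}" "Q \<in> pairings ok {Suc i..<b}" "R \<in> pairings ok {Suc b..<j}"
        and "P = insert {i, b} (Q \<union> R)" by blast
      then have "P = ?f (b, Q, R)" "(b, Q, R) \<in> ?D" by simp_all
      then show "P \<in> ?f ` ?D" by blast
    qed
  qed
  then have "card (pairings ok {i..<j}) = card ?D"
    by (rule bij_betw_same_card[symmetric])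
  also have "\<dots> = (\<Sum>b\<in>?B. card (pairings ok {Suc i..<b} \<times> pairings ok {Suc b..<j}))"
    by (rule card_SigmaI) (auto simp: finite_pairings)
  finally show ?thesis unfolding card_cartesian_product .
qed

section \<open>Which positions the letters allow to be joined\<close>

text \<open>The colour condition in terms of positions. Letters \<open>i\<close> and \<open>i*\<close> sit at residues \<open>i\<close> and \<open>9 - i\<close>
  modulo 8, with sum 1; the additional pairs \<open>{2, 3}\<close> and \<open>{3*, 2*}\<close> sit at residues \<open>2, 3\<close> and \<open>6, 7\<close>, with
  sum 5. The clause modulo 4 excludes \<open>{1, 4}\<close> and \<open>{4*, 1*}\<close>, which have sum 5 as well.\<close>
definition matches :: "nat \<Rightarrow> nat \<Rightarrow> bool" where
  "matches a b \<longleftrightarrow> (a + b) mod 8 = 1 \<or> (a + b) mod 8 = 5 \<and> a mod 4 \<in> {2, 3}"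

lemma matches_commute: "matches a b \<longleftrightarrow> matches b a"
proof -
  have "a mod 4 \<in> {2, 3} \<longleftrightarrow> b mod 4 \<in> {2, 3}" if "(a + b) mod 8 = 5"
  proof -
    have "(a + b) mod 8 mod 4 = (a + b) mod 4" by (simp add: mod_mod_cancel)
    then have "(a mod 4 + b mod 4) mod 4 = 1" using that by (simp add: mod_add_eq)
    moreover have "x \<in> {0, 1, 2, 3}" if "x < 4" for x :: nat using that by auto
    then have "a mod 4 \<in> {0, 1, 2, 3}" "b mod 4 \<in> {0, 1, 2, 3}" by simp_all
    ultimately show ?thesis by (elim insertE emptyE) simp_all
  qed
  then show ?thesis unfolding matches_def by (auto simp: add.commute)
qed

text \<open>Moving on by half a period exchanges the letters \<open>i\<close> and \<open>(5 - i)*\<close>, and this preserves the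
  admissible pairs of letters.\<close>
lemma matches_shift: "matches (a + 4) (b + 4) \<longleftrightarrow> matches a b"
proof -
  have "a + 4 + (b + 4) = a + b + 8" by simp
  then show ?thesis unfolding matches_def by (simp only: mod_add_self2)
qed

definition letter_pair :: "nat set \<Rightarrow> bool" where
  "letter_pair V \<longleftrightarrow> (\<exists>a b. V = {a, b} \<and> matches a b)"

lemma letter_pair_iff: "letter_pair {a, b} \<longleftrightarrow> matches a b"
  unfolding letter_pair_def using matches_commute by (auto simp: doubleton_eq_iff)

lemma nth_concat_replicate:
  "i < n * length xs \<Longrightarrow> concat (replicate n xs) ! i = xs ! (i mod length xs)"
proof (induction n arbitrary: i)
  case (Suc n)
  show ?case
  proof (cases "i < length xs")
    case False
    then have "i - length xs < n * length xs" "i mod length xs = (i - length xs) mod length xs"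
      using Suc.prems by (auto simp: le_mod_geq)
    then show ?thesis using False Suc.IH by (simp add: nth_append)
  qed (simp add: nth_append)
qed simp

lemma color_eq:
  assumes "s \<in> {1..8 * n}"
  shows "color n s = W_tilde ! ((s - 1) mod 8)"
  unfolding color_def using nth_concat_replicate[of "s - 1" n W_tilde] assms
  by (auto simp: W_tilde_def)

lemma admissible_colors_eq:
  "admissible_colors = {{Plain 1, Star 1}, {Plain 2, Star 2}, {Plain 3, Star 3}, {Plain 4, Star 4},
    {Plain 2, Plain 3}, {Star 3, Star 2}}"
  unfolding admissible_colors_def by auto

lemma admissible_table:
  assumes "x < 8" "y < 8"
  shows "{W_tilde ! x, W_tilde ! y} \<in> admissible_colors \<longleftrightarrow>
    (x + y + 2) mod 8 = 1 \<or> (x + y + 2) mod 8 = 5 \<and> (x + 1) mod 4 \<in> {2, 3}"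
proof -
  have cases8: "c = 0 \<or> c = 1 \<or> c = 2 \<or> c = 3 \<or> c = 4 \<or> c = 5 \<or> c = 6 \<or> c = 7" if "c < 8" for c :: nat
    using that by linarith
  have nth: "W_tilde ! 0 = Plain 1" "W_tilde ! 1 = Plain 2" "W_tilde ! 2 = Plain 3" "W_tilde ! 3 = Plain 4"
    "W_tilde ! 4 = Star 4" "W_tilde ! 5 = Star 3" "W_tilde ! 6 = Star 2" "W_tilde ! 7 = Star 1"
    by (simp_all add: W_tilde_def)
  \<comment> \<open>All 64 pairs of letters are checked.\<close>
  from cases8[OF assms(1)] cases8[OF assms(2)] show ?thesis
    unfolding admissible_colors_eq
    by (elim disjE; hypsubst; unfold nth; simp add: doubleton_eq_iff)
qed

lemma admissible_iff_matches:
  assumes "1 \<le> a" "1 \<le> b"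
  shows "{W_tilde ! ((a - 1) mod 8), W_tilde ! ((b - 1) mod 8)} \<in> admissible_colors \<longleftrightarrow> matches a b"
proof -
  obtain u v where uv: "a = u + 1" "b = v + 1"
    using assms by (metis le_add_diff_inverse2)
  define x y where "x = u mod 8" and "y = v mod 8"
  have "(u + v + 2) mod 8 = (x + y + 2) mod 8"
    unfolding x_def y_def by (rule mod_add_cong[OF mod_add_eq[symmetric] refl])
  then have sum: "(a + b) mod 8 = (x + y + 2) mod 8" unfolding uv by simp
  have "u mod 4 = x mod 4" unfolding x_def by (simp add: mod_mod_cancel)
  then have four: "a mod 4 = (x + 1) mod 4" unfolding uv by (rule mod_add_cong[OF _ refl])
  have colors: "{W_tilde ! x, W_tilde ! y} \<in> admissible_colors \<longleftrightarrow>
      (x + y + 2) mod 8 = 1 \<or> (x + y + 2) mod 8 = 5 \<and> (x + 1) mod 4 \<in> {2, 3}"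
    by (rule admissible_table) (simp_all add: x_def y_def)
  show ?thesis
    unfolding matches_def sum four colors[symmetric] unfolding uv x_def y_def by simp
qed

lemma NC2_W_tilde_eq_pairings: "NC2_W_tilde n = pairings letter_pair {1..8 * n}"
proof -
  have "color n ` V \<in> admissible_colors \<longleftrightarrow> letter_pair V"
    if V: "V \<subseteq> {1..8 * n}" "card V = 2" for V
  proof -
    obtain a b where ab: "V = {a, b}" using V(2) by (meson card_2_iff)
    then have "a \<in> {1..8 * n}" "b \<in> {1..8 * n}" using V(1) by auto
    then show ?thesis using admissible_iff_matches[of a b]
      unfolding ab letter_pair_iff image_insert image_empty by (simp add: color_eq)
  qed
  then show ?thesis
    unfolding NC2_W_tilde_def pairings_def noncrossing_partition_on_def partition_on_def
    by blast
qed

definition follows :: "nat \<Rightarrow> nat \<Rightarrow> bool" where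
  "follows s t \<longleftrightarrow> [int t = int s + 1] (mod 4) \<or> [int t = 1 - int s] (mod 4)"

lemma follows_iff: "follows s t \<longleftrightarrow> t mod 4 = (s + 1) mod 4 \<or> (s + t) mod 4 = 1"
proof -
  have 1: "[int t = int s + 1] (mod 4) \<longleftrightarrow> t mod 4 = (s + 1) mod 4"
    using cong_int_iff[of t "s + 1" 4] by (simp add: cong_def add.commute)
  have "[int t = 1 - int s] (mod 4) \<longleftrightarrow> [int (s + t) = int 1] (mod 4)"
    by (simp add: cong_iff_dvd_diff algebra_simps)
  also have "\<dots> \<longleftrightarrow> (s + t) mod 4 = 1"
    using cong_int_iff[of "s + t" 1 4] by (simp add: cong_def)
  finally show ?thesis unfolding follows_def 1 by blast
qed

text \<open>The sum \<open>2 (s + t) - 1\<close> of the two ends is 1 modulo 8 iff \<open>s + t\<close> is 1 modulo 4, and 5 modulo 8 iff \<open>s + t\<close>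
  is 3 modulo 4. For even \<open>s\<close>, \<open>t \<equiv> s + 1\<close> means \<open>s + t \<equiv> 1\<close> and is the second alternative again; for odd
  \<open>s\<close> it means \<open>s + t \<equiv> 3\<close>, which gives the pairs \<open>{2, 3}\<close> and \<open>{3*, 2*}\<close>.\<close>
lemma matches_arc_iff:
  assumes "1 \<le> t"
  shows "matches (2 * s) (2 * t - 1) \<longleftrightarrow> follows s t"
proof -
  obtain t' where t: "t = t' + 1" using assms by (metis le_add_diff_inverse2)
  define x y where "x = s mod 4" and "y = t' mod 4"
  have "x < 4" "y < 4" by (simp_all add: x_def y_def)
  have "2 * (s + t') mod 8 = 2 * ((s + t') mod 4)"
    using mult_mod_right[of 2 "s + t'" 4] by simp
  also have "(s + t') mod 4 = (x + y) mod 4"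
    unfolding x_def y_def by (rule mod_add_eq[symmetric])
  finally have "2 * (s + t') mod 8 = 2 * ((x + y) mod 4)" .
  then have "(2 * (s + t') + 1) mod 8 = (2 * ((x + y) mod 4) + 1) mod 8"
    by (metis mod_add_left_eq)
  then have sum: "(2 * s + (2 * t - 1)) mod 8 = (2 * ((x + y) mod 4) + 1) mod 8"
    unfolding t by (simp add: algebra_simps)
  have four: "2 * s mod 4 = 2 * x mod 4"
    unfolding x_def by (rule mod_mult_right_eq[symmetric])
  have t4: "t mod 4 = (y + 1) mod 4" and s4: "(s + 1) mod 4 = (x + 1) mod 4"
    unfolding t x_def y_def by (simp_all only: mod_add_left_eq)
  have st4: "(s + t) mod 4 = (x + (y + 1)) mod 4"
    using t4 by (intro mod_add_cong) (simp_all add: x_def)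
  have cases4: "c = 0 \<or> c = 1 \<or> c = 2 \<or> c = 3" if "c < 4" for c :: nat
    using that by linarith
  show ?thesis
    unfolding matches_def follows_iff sum four t4 s4 st4
    using cases4[OF \<open>x < 4\<close>] cases4[OF \<open>y < 4\<close>] by (elim disjE; simp)
qed

lemma matches_parity: "matches a b \<Longrightarrow> even a \<noteq> even b"
proof -
  assume "matches a b"
  then have "(a + b) mod 8 = 1 \<or> (a + b) mod 8 = 5" by (auto simp: matches_def)
  moreover have "odd w" if "w mod 8 = 1 \<or> w mod 8 = 5" for w :: nat using that by presburger
  ultimately have "odd (a + b)" by blast
  then show ?thesis by simp
qed

text \<open>Matching positions have odd sum, so an admissible pair consists of one even and one odd point, as
  an arc does.\<close>
lemma letter_pair_iff_arc:
  assumes "V \<subseteq> {1..2 * m}" "card V = 2"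
  shows "letter_pair V \<longleftrightarrow> (\<exists>s\<in>{1..m}. \<exists>t\<in>{1..m}. V = {2 * s, 2 * t - 1} \<and> follows s t)"
proof
  assume "letter_pair V"
  then obtain a b where ab: "V = {a, b}" "matches a b" "even a"
    unfolding letter_pair_def by (metis insert_commute matches_commute matches_parity)
  then obtain s where s: "a = 2 * s" by (auto elim: evenE)
  have "odd b" using ab matches_parity by blast
  then obtain t' where "b = 2 * t' + 1" by (auto elim: oddE)
  then have t: "b = 2 * (t' + 1) - 1" by simp
  have "s \<in> {1..m}" "t' + 1 \<in> {1..m}" using assms(1) unfolding ab s t by auto
  then show "\<exists>s\<in>{1..m}. \<exists>t\<in>{1..m}. V = {2 * s, 2 * t - 1} \<and> follows s t"
  proof (intro bexI conjI)
    show "V = {2 * s, 2 * (t' + 1) - 1}" using ab(1) unfolding s t .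
    show "follows s (t' + 1)" using ab(2) matches_arc_iff[of "t' + 1" s] unfolding s t by simp
  qed
next
  assume "\<exists>s\<in>{1..m}. \<exists>t\<in>{1..m}. V = {2 * s, 2 * t - 1} \<and> follows s t"
  then show "letter_pair V" using matches_arc_iff letter_pair_iff by auto
qed

lemma card_NC_W_eq: "card (NC_W n) = card (NC2_W_tilde n)"
proof -
  have W: "NC_W n = {P. noncrossing_partition_on {1..4 * n} P \<and> (\<forall>V\<in>P. \<forall>s\<in>V. follows s (block_succ V s))}"
    unfolding NC_W_def follows_def ..
  have "NC2_W_tilde n = {Q. noncrossing_partition_on {1..2 * (4 * n)} Q \<and>
      (\<forall>q\<in>Q. \<exists>s\<in>{1..4 * n}. \<exists>t\<in>{1..4 * n}. q = {2 * s, 2 * t - 1} \<and> follows s t)}"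
  proof -
    have two: "card {2 * s, 2 * t - 1} = 2" if "t \<in> {1..4 * n}" for s t :: nat
      using even_neq_odd[of t s] that by simp
    have "(\<forall>V\<in>Q. card V = 2 \<and> letter_pair V) \<longleftrightarrow>
       (\<forall>q\<in>Q. \<exists>s\<in>{1..4 * n}. \<exists>t\<in>{1..4 * n}. q = {2 * s, 2 * t - 1} \<and> follows s t)"
      if Q: "noncrossing_partition_on {1..2 * (4 * n)} Q" for Q
    proof (rule ball_cong[OF refl])
      fix V assume "V \<in> Q"
      then have V: "V \<subseteq> {1..2 * (4 * n)}"
        using Q unfolding noncrossing_partition_on_def partition_on_def by blast
      show "card V = 2 \<and> letter_pair V \<longleftrightarrow>
        (\<exists>s\<in>{1..4 * n}. \<exists>t\<in>{1..4 * n}. V = {2 * s, 2 * t - 1} \<and> follows s t)"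
        using letter_pair_iff_arc[OF V] two by blast
    qed
    moreover have "8 * n = 2 * (4 * n)" by simp
    ultimately show ?thesis
      unfolding NC2_W_tilde_eq_pairings pairings_def by (metis (no_types, lifting))
  qed
  then show ?thesis using bij_betw_same_card[OF bij_betw_arcs[of "4 * n" follows]] unfolding W by simp
qed

section \<open>Generating functions of the admissible pairings\<close>

definition npairings :: "nat \<Rightarrow> nat \<Rightarrow> nat" where
  "npairings i L = card (pairings letter_pair {i..<i + L})"

lemma npairings_0: "npairings i 0 = 1"
  by (simp add: npairings_def pairings_empty)

lemma npairings_Suc:
  "npairings i (Suc L) = (\<Sum>k<L. if matches i (Suc i + k)
     then npairings (Suc i) k * npairings (i + k + 2) (L - Suc k) else 0)"
proof -
  have "npairings i (Suc L) = (\<Sum>b | i < b \<and> b < i + Suc L \<and> matches i b.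
      card (pairings letter_pair {Suc i..<b}) * card (pairings letter_pair {Suc b..<i + Suc L}))"
    unfolding npairings_def by (subst card_pairings_rec) (simp_all add: letter_pair_iff)
  also have "\<dots> = (\<Sum>k | k < L \<and> matches i (Suc i + k). npairings (Suc i) k * npairings (i + k + 2) (L - Suc k))"
    by (rule sum.reindex_bij_witness[of _ "\<lambda>k. Suc i + k" "\<lambda>b. b - Suc i"])
      (auto simp: npairings_def add_ac)
  also have "\<dots> = (\<Sum>k<L. if matches i (Suc i + k)
     then npairings (Suc i) k * npairings (i + k + 2) (L - Suc k) else 0)"
    by (simp add: sum.inter_filter[symmetric] Collect_conj_eq lessThan_def)
  finally show ?thesis .
qed

lemma npairings_shift: "npairings (i + 4) L = npairings i L"
proof (induction L arbitrary: i rule: less_induct)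
  case (less L)
  show ?case
  proof (cases L)
    case 0
    then show ?thesis by (simp add: npairings_0)
  next
    case (Suc M)
    have "npairings (Suc (i + 4)) k = npairings (Suc i) k" if "k < M" for k
      using less.IH[of k "Suc i"] that Suc by simp
    moreover have "npairings (i + 4 + k + 2) (M - Suc k) = npairings (i + k + 2) (M - Suc k)" if "k < M" for k
      using less.IH[of "M - Suc k" "i + k + 2"] that Suc by (simp add: add_ac)
    moreover have "matches (i + 4) (Suc (i + 4) + k) \<longleftrightarrow> matches i (Suc i + k)" for k
      using matches_shift[of i "Suc i + k"] by (simp add: add_ac)
    ultimately show ?thesis unfolding Suc npairings_Suc by (intro sum.cong) auto
  qed
qed

lemma npairings_period: "npairings (i + 8 * q) L = npairings i L"
proof (induction q)
  case (Suc q)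
  then show ?case
    using npairings_shift[of "i + 8 * q + 4" L] npairings_shift[of "i + 8 * q" L] by (simp add: add_ac)
qed simp

text \<open>Pairings of the words that start with the \<open>i\<close>-th letter and have length congruent to \<open>r\<close> modulo 8,
  counted by the number of complete periods.\<close>
definition series :: "nat \<Rightarrow> nat \<Rightarrow> real fps" where
  "series i r = Abs_fps (\<lambda>n. real (npairings i (8 * n + r)))"

lemma series_shift: "series (i + 4) r = series i r"
  by (simp add: series_def npairings_shift)

text \<open>The contribution of the partners at distance \<open>c + 1\<close> modulo 8 from the first point. The two parts
  have lengths \<open>c\<close> and \<open>r - (c + 2)\<close> modulo 8. If \<open>c + 2\<close> exceeds \<open>r\<close>, the remainders of the two parts
  and the two ends of the arc use up one period more than the remainder \<open>r\<close> provides, whence the factor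
  \<open>fps_X\<close>.\<close>
definition first_partner_series :: "nat \<Rightarrow> nat \<Rightarrow> nat \<Rightarrow> real fps" where
  "first_partner_series i r c = (if c + 2 \<le> r then series (i + 1) c * series (i + c + 2) (r - (c + 2))
     else fps_X * (series (i + 1) c * series (i + c + 2) (r + 8 - (c + 2))))"

lemma sum_by_residue:
  fixes g :: "nat \<Rightarrow> real"
  assumes "\<And>k. P k \<longleftrightarrow> k mod 8 \<in> C" "C \<subseteq> {..<8}"
  shows "(\<Sum>k<L. if P k then g k else 0) = (\<Sum>c\<in>C. \<Sum>q | 8 * q + c < L. g (8 * q + c))"
proof -
  have finC: "finite C" using assms(2) finite_subset by blast
  have fin: "finite {q. 8 * q + c < L}" for c
    by (rule finite_subset[of _ "{..<L}"]) auto
  have "(\<Sum>k<L. if P k then g k else 0) = (\<Sum>k | k < L \<and> P k. g k)"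
    by (simp add: sum.inter_filter[symmetric] Collect_conj_eq lessThan_def)
  also have "\<dots> = (\<Sum>(c, q)\<in>(SIGMA c:C. {q. 8 * q + c < L}). g (8 * q + c))"
    by (rule sum.reindex_bij_witness[of _ "\<lambda>(c, q). 8 * q + c" "\<lambda>k. (k mod 8, k div 8)"])
      (use assms in \<open>auto simp: mod_mult_self3 subset_iff\<close>)
  also have "\<dots> = (\<Sum>c\<in>C. \<Sum>q | 8 * q + c < L. g (8 * q + c))"
    by (rule sum.Sigma[symmetric]) (use finC fin in auto)
  finally show ?thesis .
qed

text \<open>The recursion for the number of pairings, with the partners of the first point grouped by their
  residue modulo 8. Within one residue class the sum is a Cauchy product, because the number of
  pairings of a word depends on its first letter and its length only.\<close>
lemma series_rec:
  assumes C: "\<And>k. matches i (Suc i + k) \<longleftrightarrow> k mod 8 \<in> C" "C \<subseteq> {..6}" and r: "r < 8"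
  shows "series i r = (if r = 0 then 1 else 0) + (\<Sum>c\<in>C. first_partner_series i r c)"
proof (rule fps_ext)
  fix n
  let ?L = "8 * n + r"
  have C8: "C \<subseteq> {..<8}" using C(2) by (auto simp: subset_iff)
  have split: "first_partner_series i r c $ n = (\<Sum>q | 8 * q + c < ?L - 1.
      real (npairings (Suc i) (8 * q + c)) * real (npairings (i + (8 * q + c) + 2) (?L - 1 - Suc (8 * q + c))))"
    if "c \<in> C" for c
  proof -
    have c: "c \<le> 6" using C(2) that by auto
    have per: "npairings (i + (8 * q + c) + 2) M = npairings (i + c + 2) M" for q M
      using npairings_period[of "i + c + 2" q M] by (simp add: add_ac)
    show ?thesis
    proof (cases "c + 2 \<le> r")
      case True
      then have "{q. 8 * q + c < ?L - 1} = {0..n}" using r by auto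
      moreover have "?L - 1 - Suc (8 * q + c) = 8 * (n - q) + (r - (c + 2))" if "q \<le> n" for q
        using that True by (simp add: diff_mult_distrib2)
      ultimately show ?thesis using True
        by (simp add: first_partner_series_def fps_mult_nth series_def per[simplified])
    next
      case False
      show ?thesis
      proof (cases n)
        case 0
        have "{q. 8 * q + c < ?L - 1} = {}" using False 0 by auto
        then show ?thesis using False 0 by (simp add: first_partner_series_def)
      next
        case (Suc m)
        have "{q. 8 * q + c < ?L - 1} = {0..m}" using False Suc c by auto
        moreover have "?L - 1 - Suc (8 * q + c) = 8 * (m - q) + (r + 8 - (c + 2))" if "q \<le> m" for q
          using that False Suc c by (simp add: diff_mult_distrib2)
        moreover have "first_partner_series i r c $ n = (series (i + 1) c * series (i + c + 2) (r + 8 - (c + 2))) $ m"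
          using False Suc by (simp add: first_partner_series_def)
        ultimately show ?thesis
          by (simp add: fps_mult_nth series_def per[simplified])
      qed
    qed
  qed
  show "series i r $ n = ((if r = 0 then 1 else 0) + (\<Sum>c\<in>C. first_partner_series i r c)) $ n"
  proof (cases ?L)
    case 0
    then have 0: "n = 0" "r = 0" by auto
    have "(\<Sum>c\<in>C. first_partner_series i r c $ n) = (\<Sum>c\<in>C. 0)"
      by (rule sum.cong) (simp_all add: first_partner_series_def 0)
    then show ?thesis using 0 by (simp add: series_def npairings_0 fps_sum_nth)
  next
    case (Suc M)
    have "series i r $ n = real (npairings i (Suc M))" using Suc by (simp add: series_def)
    also have "\<dots> = (\<Sum>k<M. if matches i (Suc i + k)
        then real (npairings (Suc i) k) * real (npairings (i + k + 2) (M - Suc k)) else 0)"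
      unfolding npairings_Suc by (simp add: if_distrib[of real] cong: if_cong)
    also have "\<dots> = (\<Sum>c\<in>C. first_partner_series i r c $ n)"
      unfolding sum_by_residue[OF C(1) C8] using split Suc by (intro sum.cong) simp_all
    also have "\<dots> = ((if r = 0 then 1 else 0) + (\<Sum>c\<in>C. first_partner_series i r c)) $ n"
      using Suc by (auto simp: fps_sum_nth)
    finally show ?thesis .
  qed
qed

lemma matches_residues:
  "matches 1 (2 + k) \<longleftrightarrow> k mod 8 \<in> {6}"
  "matches 2 (3 + k) \<longleftrightarrow> k mod 8 \<in> {0, 4}"
  "matches 3 (4 + k) \<longleftrightarrow> k mod 8 \<in> {2, 6}"
  "matches 4 (5 + k) \<longleftrightarrow> k mod 8 \<in> {0}"
proof -
  define x where "x = k mod 8"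
  have shift: "(a + (b + k)) mod 8 = (a + b + x) mod 8" for a b
    unfolding x_def add.assoc[symmetric] by (simp only: mod_add_right_eq)
  have "x < 8" by (simp add: x_def)
  then consider "x = 0" | "x = 1" | "x = 2" | "x = 3" | "x = 4" | "x = 5" | "x = 6" | "x = 7"
    by linarith
  then have "(1 + 2 + x) mod 8 = 1 \<longleftrightarrow> x = 6"
    "(2 + 3 + x) mod 8 = 1 \<or> (2 + 3 + x) mod 8 = 5 \<longleftrightarrow> x = 0 \<or> x = 4"
    "(3 + 4 + x) mod 8 = 1 \<or> (3 + 4 + x) mod 8 = 5 \<longleftrightarrow> x = 2 \<or> x = 6"
    "(4 + 5 + x) mod 8 = 1 \<longleftrightarrow> x = 0"
    by (cases; simp)+
  then show "matches 1 (2 + k) \<longleftrightarrow> k mod 8 \<in> {6}"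
    "matches 2 (3 + k) \<longleftrightarrow> k mod 8 \<in> {0, 4}"
    "matches 3 (4 + k) \<longleftrightarrow> k mod 8 \<in> {2, 6}"
    "matches 4 (5 + k) \<longleftrightarrow> k mod 8 \<in> {0}"
    unfolding matches_def shift x_def[symmetric] by simp_all
qed

text \<open>Starting from the full words \<open>series 1 0\<close>, repeated splitting at the first partner reaches
  only the eleven series on the left, up to shifts by 4 positions.\<close>
lemma series_system:
  "series 1 0 = 1 + fps_X * (series 2 6 * series 1 0)"
  "series 4 0 = 1 + fps_X * (series 1 0 * series 2 6)"
  "series 2 0 = 1 + (fps_X * (series 3 0 * series 4 6) + fps_X * (series 3 4 * series 4 2))"
  "series 3 0 = 1 + (fps_X * (series 4 2 * series 3 4) + fps_X * (series 4 6 * series 3 0))"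
  "series 2 2 = series 3 0 * series 4 0 + fps_X * (series 3 4 * series 4 4)"
  "series 2 4 = series 3 0 * series 4 2 + fps_X * (series 3 4 * series 4 6)"
  "series 2 6 = series 3 0 * series 4 4 + series 3 4 * series 4 0"
  "series 3 4 = series 4 2 * series 3 0 + fps_X * (series 4 6 * series 3 4)"
  "series 4 2 = series 1 0 * series 2 0"
  "series 4 4 = series 1 0 * series 2 2"
  "series 4 6 = series 1 0 * series 2 4"
proof -
  \<comment> \<open>By the half-period shift the first position may be taken among 1, 2, 3, 4.\<close>
  have sh: "series 5 r = series 1 r" "series 6 r = series 2 r" "series 7 r = series 3 r" "series 8 r = series 4 r" "series 9 r = series 1 r"
    "series 11 r = series 3 r" for r
    using series_shift[of 1 r] series_shift[of 2 r] series_shift[of 3 r] series_shift[of 4 r] series_shift[of 5 r] series_shift[of 7 r]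
    by simp_all
  have 1: "series 1 r = (if r = 0 then 1 else 0) + first_partner_series 1 r 6" if "r < 8" for r
    using series_rec[of 1 "{6}" r] matches_residues(1) that by (simp add: numeral_2_eq_2[symmetric])
  have 2: "series 2 r = (if r = 0 then 1 else 0) + (first_partner_series 2 r 0 + first_partner_series 2 r 4)" if "r < 8" for r
    using series_rec[of 2 "{0, 4}" r] matches_residues(2) that by simp
  have 3: "series 3 r = (if r = 0 then 1 else 0) + (first_partner_series 3 r 2 + first_partner_series 3 r 6)" if "r < 8" for r
    using series_rec[of 3 "{2, 6}" r] matches_residues(3) that by simp
  have 4: "series 4 r = (if r = 0 then 1 else 0) + first_partner_series 4 r 0" if "r < 8" for r
    using series_rec[of 4 "{0}" r] matches_residues(4) that by simp
  show "series 1 0 = 1 + fps_X * (series 2 6 * series 1 0)"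
    by (subst 1) (simp_all add: first_partner_series_def sh numeral_2_eq_2)
  show "series 4 0 = 1 + fps_X * (series 1 0 * series 2 6)"
    by (subst 4) (simp_all add: first_partner_series_def sh)
  show "series 2 0 = 1 + (fps_X * (series 3 0 * series 4 6) + fps_X * (series 3 4 * series 4 2))"
    by (subst 2) (simp_all add: first_partner_series_def sh)
  show "series 3 0 = 1 + (fps_X * (series 4 2 * series 3 4) + fps_X * (series 4 6 * series 3 0))"
    by (subst 3) (simp_all add: first_partner_series_def sh)
  show "series 2 2 = series 3 0 * series 4 0 + fps_X * (series 3 4 * series 4 4)"
    by (subst 2) (simp_all add: first_partner_series_def sh)
  show "series 2 4 = series 3 0 * series 4 2 + fps_X * (series 3 4 * series 4 6)"
    by (subst 2) (simp_all add: first_partner_series_def sh)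
  show "series 2 6 = series 3 0 * series 4 4 + series 3 4 * series 4 0"
    by (subst 2) (simp_all add: first_partner_series_def sh)
  show "series 3 4 = series 4 2 * series 3 0 + fps_X * (series 4 6 * series 3 4)"
    by (subst 3) (simp_all add: first_partner_series_def sh)
  show "series 4 2 = series 1 0 * series 2 0"
    by (subst 4) (simp_all add: first_partner_series_def sh)
  show "series 4 4 = series 1 0 * series 2 2"
    by (subst 4) (simp_all add: first_partner_series_def sh)
  show "series 4 6 = series 1 0 * series 2 4"
    by (subst 4) (simp_all add: first_partner_series_def sh)
qed

lemma card_NC2_W_tilde: "real (card (NC2_W_tilde n)) = series 1 0 $ n"
proof -
  have "{1..8 * n} = {1..<1 + 8 * n}" by auto
  then show ?thesis by (simp add: NC2_W_tilde_eq_pairings series_def npairings_def)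
qed

text \<open>With \<open>M = z m\<close> and \<open>K = z f h\<close>, the equations reduce to \<open>e (1 - M - K) = 1 = f (1 - M - K)\<close> and to
  \<open>K (1 - M) = z f\<^sup>2 e\<^sup>2 = M (1 - K)\<close>. The first gives \<open>e = f\<close>, the second \<open>K = M\<close>, and then \<open>f (1 - 2 M) = 1\<close>
  and \<open>M (1 - M) = z f\<^sup>4\<close> combine by squaring.\<close>
lemma system_solution:
  fixes z :: "'a::idom"
  assumes f: "f = 1 + z * (g * f)" and f4: "f4 = 1 + z * (f * g)"
    and s2: "s2 = 1 + (z * (e * m) + z * (h * l))"
    and e: "e = 1 + (z * (l * h) + z * (m * e))"
    and u: "u = e * f4 + z * (h * k)" and v: "v = e * l + z * (h * m)"
    and g: "g = e * k + h * f4" and h: "h = l * e + z * (m * h)"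
    and l: "l = f * s2" and k: "k = f * u" and m: "m = f * v"
    and nz: "1 - z * f * h \<noteq> 0"
  shows "f ^ 2 = 1 + 4 * z * f ^ 6"
proof -
  define M K where "M = z * m" and "K = z * f * h"
  have f4': "f4 = f" unfolding f4 by (subst f) (simp add: algebra_simps)
  have s2': "s2 = e" unfolding s2 by (subst e) (simp add: algebra_simps)
  note l = l[unfolded s2'] and u = u[unfolded f4'] and g = g[unfolded f4']
  have m1: "m * (1 - K) = f ^ 2 * e ^ 2"
    using m unfolding v l K_def by (simp add: algebra_simps power2_eq_square)
  have k1: "k * (1 - K) = f ^ 2 * e"
    using k unfolding u K_def by (simp add: algebra_simps power2_eq_square)
  have "m * (1 - K) = (e * k) * (1 - K)"
    unfolding m1 using k1 by (simp add: power2_eq_square mult_ac)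
  then have mk: "m = e * k" using nz unfolding K_def by simp
  have f1: "f * (1 - M - K) = 1"
    using f unfolding g mk M_def K_def by (simp add: algebra_simps)
  have e1: "e * (1 - M - K) = 1"
    using e unfolding l M_def K_def by (simp add: algebra_simps)
  have ef: "e = f" using f1 e1 by (metis mult.assoc mult.commute mult.right_neutral)
  have "h * (1 - M) = f ^ 3"
    using h unfolding l M_def ef by (simp add: algebra_simps eval_nat_numeral)
  then have "z * f * (h * (1 - M)) = z * f * f ^ 3" by simp
  then have "K * (1 - M) = z * f ^ 4"
    unfolding K_def by (simp add: mult_ac eval_nat_numeral)
  moreover have M1: "M * (1 - K) = z * f ^ 4"
  proof -
    have "M * (1 - K) = z * (m * (1 - K))" by (simp add: M_def mult.assoc)
    also have "\<dots> = z * f ^ 4" unfolding m1 ef by (simp add: eval_nat_numeral)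
    finally show ?thesis .
  qed
  ultimately have KM: "K = M" by (simp add: algebra_simps)
  have f2: "f * (1 - 2 * M) = 1" using f1 KM by (simp add: algebra_simps)
  have "1 = (f * (1 - 2 * M)) ^ 2" using f2 by simp
  also have "\<dots> = f ^ 2 - 4 * f ^ 2 * (M * (1 - K))" unfolding KM by algebra
  also have "\<dots> = f ^ 2 - 4 * z * f ^ 6" unfolding M1 by algebra
  finally show ?thesis by algebra
qed

section \<open>Powers of an algebraic series and Raney numbers\<close>

lemma gbinomial_affine_is_poly: "\<exists>q. \<forall>x. poly q x = (a + b * x) gchoose j" for a b :: real
proof (intro exI allI)
  fix x
  show "poly (smult (1 / fact j) (\<Prod>i<j. [:a - real i, b:])) x = (a + b * x) gchoose j"
    by (simp add: gbinomial_prod_rev poly_prod atLeast0LessThan algebra_simps)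
qed

text \<open>Expand \<open>(1 + U)\<^bsup>k\<^esup>\<close> by the binomial theorem. As \<open>U\<^bsup>j\<^esup>\<close> begins in degree \<open>j\<close>, only the terms
  with \<open>j \<le> n\<close> contribute, and \<open>k choose j\<close> is a polynomial in \<open>k\<close>.\<close>
lemma fps_power_nth_is_poly:
  fixes F :: "real fps"
  assumes "F $ 0 = 1"
  shows "\<exists>p. \<forall>k. poly p (real k) = (F ^ k) $ n"
proof -
  define U where "U = F - 1"
  have U0: "U $ 0 = 0" using assms by (simp add: U_def)
  have "\<forall>j. \<exists>q. \<forall>x. poly q x = (x gchoose j :: real)"
    using gbinomial_affine_is_poly[of 0 1] by simp
  then obtain q where q: "\<And>j x. poly (q j) x = (x gchoose j :: real)"
    by metis
  have "poly (\<Sum>j\<le>n. smult ((U ^ j) $ n) (q j)) (real k) = (F ^ k) $ n" for k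
  proof -
    have "F ^ k = (U + 1) ^ k" by (simp add: U_def)
    also have "\<dots> = (\<Sum>j\<le>k. of_nat (k choose j) * U ^ j)" by (simp add: binomial_ring)
    finally have "(F ^ k) $ n = (\<Sum>j\<le>k. real (k choose j) * (U ^ j) $ n)"
      by (simp add: fps_sum_nth fps_of_nat[symmetric] del: fps_const_power)
    also have "\<dots> = (\<Sum>j\<le>n. real (k choose j) * (U ^ j) $ n)"
    proof -
      have "(\<Sum>j\<le>k. real (k choose j) * (U ^ j) $ n) = (\<Sum>j\<le>n + k. real (k choose j) * (U ^ j) $ n)"
        by (rule sum.mono_neutral_left) auto
      also have "\<dots> = (\<Sum>j\<le>n. real (k choose j) * (U ^ j) $ n)"
        using startsby_zero_power_prefix[OF U0] by (intro sum.mono_neutral_right) auto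
      finally show ?thesis .
    qed
    finally show ?thesis by (simp add: poly_sum q binomial_gbinomial mult.commute)
  qed
  then show ?thesis by blast
qed

text \<open>A form of \<open>R\<^sub>n(2, r)\<close> without division. It is visibly a polynomial in \<open>r\<close> and has the right value 1 at
  \<open>n = 0\<close>, \<open>r = 0\<close>, where the quotient in \<open>raney\<close> degenerates to \<open>0 / 0 = 0\<close>.\<close>
definition raney3 :: "nat \<Rightarrow> real \<Rightarrow> real" where
  "raney3 n r = ((3 * real n + r) gchoose n) -
    (if n = 0 then 0 else 3 * ((3 * real n + r - 1) gchoose (n - 1)))"

lemma raney_eq_raney3:
  assumes "r > 0"
  shows "raney 2 r n = raney3 n r"
proof (cases n)
  case 0
  then show ?thesis using assms by (simp add: raney_def raney3_def)
next
  case (Suc m)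
  let ?x = "3 * real n + r"
  have x: "?x > 0" using assms by simp
  have "?x * ((?x - 1) gchoose m) = real n * (?x gchoose n)"
    using gbinomial_absorption[of m ?x] Suc by simp
  then have "(?x - 1) gchoose m = real n * (?x gchoose n) / ?x"
    using x by (simp add: field_simps)
  then have "raney3 n r = (?x gchoose n) - 3 * (real n * (?x gchoose n) / ?x)"
    using Suc by (simp add: raney3_def)
  also have "\<dots> = (r / ?x) * (?x gchoose n)"
    using x by (simp add: field_simps)
  finally show ?thesis by (simp add: raney_def)
qed

lemma raney3_0: "raney3 0 r = 1"
  by (simp add: raney3_def)

lemma raney3_Suc_at_0: "raney3 (Suc n) 0 = 0"
proof -
  let ?a = "3 * real (Suc n)"
  have "real (Suc n) * (?a gchoose Suc n) = real (Suc n) * (3 * ((?a - 1) gchoose n))"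
    unfolding gbinomial_absorption by (simp add: mult_ac)
  then have "?a gchoose Suc n = 3 * ((?a - 1) gchoose n)"
    unfolding mult_cancel_left by simp
  then show ?thesis by (simp add: raney3_def)
qed

text \<open>Pascal's rule in both binomial coefficients. This is the coefficientwise form of
  \<open>B\<^bsup>r + 1\<^esup> = B\<^bsup>r\<^esup> + z B\<^bsup>r + 3\<^esup>\<close>, which holds for a series with \<open>B = 1 + z B\<^sup>3\<close>.\<close>
lemma raney3_Suc: "raney3 (Suc n) (r + 1) = raney3 (Suc n) r + raney3 n (r + 3)"
proof -
  let ?x = "3 * real n + r"
  have 1: "(?x + 4) gchoose (Suc n) = ((?x + 3) gchoose n) + ((?x + 3) gchoose (Suc n))"
    using gbinomial_Suc_Suc[of "?x + 3" n] by (simp add: add.assoc)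
  have 2: "(?x + 3) gchoose n = (if n = 0 then 0 else (?x + 2) gchoose (n - 1)) + ((?x + 2) gchoose n)"
    using gbinomial_Suc_Suc[of "?x + 2" "n - 1"] by (cases n) (simp_all add: add.assoc)
  have a: "3 * real (Suc n) + (r + 1) = ?x + 4" "3 * real (Suc n) + r = ?x + 3"
    "3 * real n + (r + 3) = ?x + 3" "?x + 4 - 1 = ?x + 3" "?x + 3 - 1 = ?x + 2" by simp_all
  define A B C D E where "A = ((?x + 4) gchoose (Suc n))" and "B = ((?x + 3) gchoose n)"
    and "C = ((?x + 3) gchoose (Suc n))" and "D = ((?x + 2) gchoose (n - 1))"
    and "E = ((?x + 2) gchoose n)"
  note fold = A_def[symmetric] B_def[symmetric] C_def[symmetric] D_def[symmetric] E_def[symmetric]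
  show ?thesis unfolding raney3_def a diff_Suc_1 fold
    using 1 2 unfolding fold by (cases "n = 0") simp_all
qed

text \<open>Multiplying the equation for \<open>F\<^sup>2\<close> by \<open>F\<^bsup>2 k\<^esup>\<close> gives a recursion whose inhomogeneous term has
  lower degree, and \<open>raney3_Suc\<close> shows that the right-hand side obeys the same recursion. It starts at \<open>k = 0\<close>,
  which is why only even exponents are reached.\<close>
lemma even_power_nth:
  fixes F :: "real fps"
  assumes F: "F ^ 2 = 1 + 4 * fps_X * F ^ 6"
  shows "(F ^ (2 * k)) $ n = 4 ^ n * raney3 n (real k)"
proof (induction n arbitrary: k)
  case 0
  have "F ^ 2 $ 0 = 1" by (subst F) (simp add: mult.assoc)
  then show ?case by (simp add: power_mult fps_power_zeroth raney3_0)
next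
  case (Suc n)
  note IH = Suc.IH
  show ?case
  proof (induction k)
    case 0
    then show ?case by (simp add: raney3_Suc_at_0)
  next
    case (Suc k)
    \<comment> \<open>The term \<open>4 z F\<^sup>6\<close> of \<open>F\<^sup>2\<close> raises the exponent by 6, that is, \<open>k\<close> by 3.\<close>
    have "F ^ (2 * Suc k) = F ^ (2 * k) * F ^ 2" by (simp add: power_add[symmetric])
    also have "\<dots> = F ^ (2 * k) + 4 * (fps_X * F ^ (2 * (k + 3)))"
      unfolding F by (simp add: algebra_simps power_add[symmetric])
    finally have "F ^ (2 * Suc k) $ Suc n = F ^ (2 * k) $ Suc n + 4 * F ^ (2 * (k + 3)) $ n"
      by (simp add: numeral_fps_const)
    then show ?case unfolding Suc.IH IH
      using raney3_Suc[of n "real k"] by (simp add: algebra_simps)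
  qed
qed

text \<open>Both sides are polynomials in \<open>k\<close> and agree at the infinitely many even \<open>k\<close>.\<close>
lemma power_nth_eq_raney3:
  fixes F :: "real fps"
  assumes F: "F ^ 2 = 1 + 4 * fps_X * F ^ 6" and F0: "F $ 0 = 1"
  shows "(F ^ k) $ n = 4 ^ n * raney3 n (real k / 2)"
proof -
  obtain p where p: "\<And>k. poly p (real k) = (F ^ k) $ n"
    using fps_power_nth_is_poly[OF F0] by blast
  obtain q1 where q1: "\<And>x. poly q1 x = (3 * real n + 1 / 2 * x) gchoose n"
    using gbinomial_affine_is_poly by blast
  obtain q2 where q2: "\<And>x. poly q2 x = (3 * real n - 1 + 1 / 2 * x) gchoose (n - 1)"
    using gbinomial_affine_is_poly by blast
  define q where "q = smult (4 ^ n) (q1 - (if n = 0 then 0 else smult 3 q2))"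
  have q: "poly q x = 4 ^ n * raney3 n (x / 2)" for x
    by (simp add: q_def q1 q2 raney3_def algebra_simps)
  have "p = q"
  proof (rule ccontr)
    assume "p \<noteq> q"
    then have "finite {x. poly (p - q) x = 0}" by (intro poly_roots_finite) simp
    moreover have "range (\<lambda>k. real (2 * k)) \<subseteq> {x. poly (p - q) x = 0}"
    proof clarify
      fix k
      have "poly p (real (2 * k)) = poly q (real (2 * k))"
        unfolding p q even_power_nth[OF F] by simp
      then show "poly (p - q) (real (2 * k)) = 0" by simp
    qed
    ultimately have "finite (range (\<lambda>k. real (2 * k)))" by (rule finite_subset[rotated])
    moreover have "inj (\<lambda>k. real (2 * k))" by (simp add: inj_def)
    ultimately show False using range_inj_infinite by blast
  qed
  then show ?thesis using p q by simp
qed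

section \<open>The two cardinalities\<close>

lemma coeff_closed_form: "series 1 0 $ n = 4 ^ n * raney 2 (1 / 2) n"
proof -
  have "series 1 0 $ 0 = 1" by (simp add: series_def npairings_0)
  moreover have "series 1 0 ^ 2 = 1 + 4 * fps_X * series 1 0 ^ 6"
  proof (rule system_solution[OF series_system])
    have "(1 - fps_X * series 1 0 * series 3 4) $ 0 = 1" by (simp add: mult.assoc)
    then show "1 - fps_X * series 1 0 * series 3 4 \<noteq> 0" by (metis fps_zero_nth zero_neq_one)
  qed
  ultimately show ?thesis
    using power_nth_eq_raney3[of "series 1 0" 1 n] by (simp add: raney_eq_raney3)
qed

theorem corollary7p1:
  fixes n :: nat
  shows "card (NC_W n) = card (NC2_W_tilde n) \<and>
         real (card (NC2_W_tilde n)) = 4 ^ n * raney 2 (1/2) n"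
  using card_NC_W_eq card_NC2_W_tilde coeff_closed_form by simp

end
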